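(* Let $H$ be a non-empty finite subset of $\mathbb{N}_0$ and let $\alpha_H:=\inf_p\,(1-2\eta_p^H)$, where the infimum runs over all primes $p$. Then $$\Gamma_H=[\alpha_H,1]\cup[0,1].$$
   Context: $\mathbb{N}=\{1,2,\ldots\}$, $\mathbb{N}_0=\mathbb{N}\cup\{0\}$. For a set $P$ of primes, $\lambda_P:\mathbb{N}\to\{\pm1\}$ is the completely multiplicative function with $\lambda_P(p)=-1$ if $p\in P$ and $\lambda_P(p)=1$ for primes $p\notin P$. For $H=\{h_1,\ldots,h_d\}$ (distinct elements), $\Lambda_P^H(n):=\lambda_P(n+h_1)\cdots\lambda_P(n+h_d)$. For a prime $p$, $\eta_p^H$ is the natural density of the set $\{n\in\mathbb{N} : \Lambda_{\{p\}}^H(n)=-1\}$ (this density exists). A set of primes is small if the sum of the reciprocals of its elements converges (finite sets, including the empty set, are small). For small $P$, $\kappa_P^H:=\lim_{x\to\infty}\frac1x\sum_{n\leqslant x}\Lambda_P^H(n)$ (this limit exists for small $P$). The spectrum $\Gamma_H$ is the topological closure (in $\mathbb{R}$) of the set of all values $\kappa_P^H$ as $P$ runs through all small sets of primes, with $H$ fixed. *)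

theory Defs
  imports "HOL-Analysis.Analysis" "HOL-Computational_Algebra.Primes"
begin

(* The factorisation is taken with multiplicity; the three lemmas below show that this is
   the completely multiplicative function with the prescribed values at the primes.
   Only arguments n >= 1 matter (the value at 0 is 1). *)
definition lambda_fun :: "nat set \<Rightarrow> nat \<Rightarrow> real" where
  "lambda_fun P n = (\<Prod>p\<in>#prime_factorization n. if p \<in> P then -1 else 1)"

lemma lambda_fun_1: "lambda_fun P 1 = 1"
  by (simp add: lambda_fun_def)

lemma lambda_fun_mult:
  "m > 0 \<Longrightarrow> n > 0 \<Longrightarrow> lambda_fun P (m * n) = lambda_fun P m * lambda_fun P n"
  by (simp add: lambda_fun_def prime_factorization_mult)

lemma lambda_fun_prime: "prime p \<Longrightarrow> lambda_fun P p = (if p \<in> P then -1 else 1)"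
  by (simp add: lambda_fun_def prime_factorization_prime)

definition Lambda_corr :: "nat set \<Rightarrow> nat set \<Rightarrow> nat \<Rightarrow> real" where
  "Lambda_corr H P n = (\<Prod>h\<in>H. lambda_fun P (n + h))"

definition natural_density :: "nat set \<Rightarrow> real" where
  "natural_density A = lim (\<lambda>N. real (card (A \<inter> {1..N})) / real N)"

definition eta :: "nat set \<Rightarrow> nat \<Rightarrow> real" where
  "eta H p = natural_density {n. n \<ge> 1 \<and> Lambda_corr H {p} n = -1}"

(* The terms are positive, so unconditional summability is just convergence of the series. *)
definition small :: "nat set \<Rightarrow> bool" where
  "small P \<longleftrightarrow> P \<subseteq> {p. prime p} \<and> (\<lambda>p. 1 / real p) summable_on P"

definition kappa :: "nat set \<Rightarrow> nat set \<Rightarrow> real" where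
  "kappa H P = Lim at_top (\<lambda>x::real. (1 / x) * (\<Sum>n\<in>{1..nat \<lfloor>x\<rfloor>}. Lambda_corr H P n))"

definition spectrum :: "nat set \<Rightarrow> real set" where
  "spectrum H = closure {kappa H P | P. small P}"

definition alpha :: "nat set \<Rightarrow> real" where
  "alpha H = (INF p\<in>{p. prime p}. 1 - 2 * eta H p)"

end

theory Submission
  imports Defs "HOL-Computational_Algebra.Squarefree" "HOL-Number_Theory.Cong"
begin

text \<open>
  For a prime $p$ write $\beta_p = 1 - 2\eta_p^H$; this is the mean value of $\Lambda_{\{p\}}^H$,
because that function only takes the values $\pm 1$. The theorem rests on the product formula
$\kappa_P^H = \prod_{p \in P} \beta_p$, which expresses that divisibility by powers of different
primes is independent. Up to an error of small mean, $\Lambda_{\{p\}}^H$ is a function with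
period a power of $p$, and the mean of a product of periodic functions with pairwise coprime periods
is the product of their means by the Chinese Remainder Theorem
(\<open>has_mean_prod_periodic\<close>). This gives the formula for finite $P$
(\<open>has_mean_Lambda_corr_finite\<close>). For small infinite $P$ the primes of $P$ beyond $k$
affect only a set of integers whose upper density is bounded by a multiple of the tail of
$\sum_{p \in P} 1/p$, so that $\kappa_P^H$ is the limit of the finite products
(\<open>has_mean_Lambda_corr_small\<close>).

  The inclusion of the spectrum in $[\alpha_H,1] \cup [0,1]$ is then elementary: all $\beta_p$ lie
in $[-1,1]$, so a negative product is at least any one of its negative factors, hence at least
$\alpha_H$.

  For the converse one needs $\beta_p = 1 - O(1/p)$ and, for large $p$, $\beta_p \le 1 - 1/p$.
Since $\sum_p 1/p$ diverges (Erdos's counting argument, \<open>prime_reciprocals_not_summable\<close>), the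
products of $\beta_p$ over the consecutive primes $y \le p < N$ decrease from $1$ to $0$ in steps that
are arbitrarily small when $y$ is large, so they come close to every $t \in [0,1]$. Multiplying such
a product by a fixed negative $\beta_q$ with $q < y$ comes close to every point of $[\beta_q, 0]$; if
$\alpha_H < 0$, these intervals cover $(\alpha_H, 0]$, and $\alpha_H$ itself follows by closedness (\<open>scaled_product_in_spectrum\<close>).
\<close>

section \<open>Mean values of arithmetic functions\<close>

definition has_mean :: "(nat \<Rightarrow> real) \<Rightarrow> real \<Rightarrow> bool" where
  "has_mean f m \<longleftrightarrow> (\<lambda>N. (\<Sum>n=1..N. f n) / real N) \<longlonglongrightarrow> m"

lemma has_mean_unique:
  assumes "has_mean f a" "has_mean f b"
  shows "a = b"
  using assms LIMSEQ_unique unfolding has_mean_def by blast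

lemma has_mean_const: "has_mean (\<lambda>_. c) c"
proof -
  have "eventually (\<lambda>N. c = (\<Sum>n=1..N. c) / real N) sequentially"
    using eventually_gt_at_top[of 0] by eventually_elim simp
  then show ?thesis unfolding has_mean_def
    by (rule Lim_transform_eventually[OF tendsto_const])
qed

lemma has_mean_diff:
  assumes "has_mean f a" "has_mean g b"
  shows "has_mean (\<lambda>n. f n - g n) (a - b)"
  using tendsto_diff[OF assms[unfolded has_mean_def]]
  by (simp add: has_mean_def sum_subtractf diff_divide_distrib)

lemma has_mean_cmult:
  assumes "has_mean f a"
  shows "has_mean (\<lambda>n. c * f n) (c * a)"
  using tendsto_mult_left[OF assms[unfolded has_mean_def], of c]
  by (simp add: has_mean_def sum_distrib_left[symmetric])

lemma has_mean_sum:
  assumes "finite I" "\<And>i. i \<in> I \<Longrightarrow> has_mean (f i) (a i)"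
  shows "has_mean (\<lambda>n. \<Sum>i\<in>I. f i n) (\<Sum>i\<in>I. a i)"
proof -
  have "(\<lambda>N. \<Sum>i\<in>I. (\<Sum>n=1..N. f i n) / real N) \<longlonglongrightarrow> (\<Sum>i\<in>I. a i)"
    using assms by (intro tendsto_sum) (simp add: has_mean_def)
  moreover have "(\<Sum>i\<in>I. (\<Sum>n=1..N. f i n) / real N) = (\<Sum>n=1..N. \<Sum>i\<in>I. f i n) / real N" for N
    by (subst sum.swap) (simp add: sum_divide_distrib)
  ultimately show ?thesis by (simp add: has_mean_def)
qed

lemma has_mean_mono:
  assumes "has_mean f a" "has_mean g b" "\<And>n. n \<ge> 1 \<Longrightarrow> f n \<le> g n"
  shows "a \<le> b"
  using assms unfolding has_mean_def
  by (elim LIMSEQ_le) (auto intro!: exI[of _ 0] divide_right_mono sum_mono)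

text \<open>
  The linear main term and a bounded remainder: this form covers both periodic functions and the
counting of multiples.
\<close>

lemma has_mean_if_bounded_discrepancy:
  assumes "\<And>N. \<bar>(\<Sum>n=1..N. f n) - m * real N\<bar> \<le> C"
  shows "has_mean f m"
proof -
  have "(\<lambda>N. (\<Sum>n=1..N. f n) / real N - m) \<longlonglongrightarrow> 0"
  proof (rule Lim_null_comparison)
    show "\<forall>\<^sub>F N in sequentially. norm ((\<Sum>n=1..N. f n) / real N - m) \<le> C / real N"
      using eventually_gt_at_top[of 0]
    proof eventually_elim
      case (elim N)
      have "(\<Sum>n=1..N. f n) / real N - m = ((\<Sum>n=1..N. f n) - m * real N) / real N"
        using elim by (simp add: field_simps)
      then show ?case using assms[of N] elim by (simp add: divide_right_mono)
    qed
    show "(\<lambda>N. C / real N) \<longlonglongrightarrow> 0" by (rule lim_const_over_n)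
  qed
  then show ?thesis unfolding has_mean_def by (simp add: LIM_zero_iff)
qed

lemma periodic_mult:
  fixes f :: "nat \<Rightarrow> 'a"
  assumes "\<And>n. f (n + D) = f n"
  shows "f (n + q * D) = f n"
proof (induction q)
  case (Suc q)
  have "n + Suc q * D = (n + q * D) + D" by simp
  then show ?case using assms Suc by metis
qed simp

lemma periodic_mod:
  fixes f :: "nat \<Rightarrow> 'a"
  assumes "\<And>n. f (n + D) = f n"
  shows "f (n mod D) = f n"
  using periodic_mult[of f D "n mod D" "n div D"] assms by simp

text \<open>
  The discrepancy between the summatory function and its linear main term is itself periodic,
because the sum over any window of one full period is the same; hence it is bounded.
\<close>

lemma has_mean_periodic:
  fixes f :: "nat \<Rightarrow> real"
  assumes D: "D > 0" and per: "\<And>n. f (n + D) = f n"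
  shows "has_mean f ((\<Sum>n<D. f n) / real D)"
proof -
  define m where "m = (\<Sum>n<D. f n) / real D"
  define E where "E N = (\<Sum>n=1..N. f n) - m * real N" for N
  have shift: "(\<Sum>n=1..N+D. f n) = (\<Sum>n=1..N. f n) + (\<Sum>n<D. f n)" for N
  proof (induction N)
    case 0
    have "(\<Sum>n=1..D. f n) + f 0 = (\<Sum>n\<le>D. f n)"
      by (simp add: atMost_atLeast0 sum.atLeast_Suc_atMost[of 0 D])
    also have "\<dots> = (\<Sum>n<D. f n) + f D"
      by (simp add: lessThan_Suc_atMost[symmetric])
    finally show ?case using per[of 0] by simp
  next
    case (Suc N)
    then show ?case using per[of "Suc N"] by simp
  qed
  have E: "E (N + D) = E N" for N
    using D shift[of N] by (simp add: E_def m_def field_simps)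
  have "E N = E (N mod D)" for N
    using periodic_mod[of E D] E by simp
  then have "\<bar>E N\<bar> \<le> (\<Sum>r<D. \<bar>E r\<bar>)" for N
    using D by (metis abs_ge_zero finite_lessThan lessThan_iff member_le_sum mod_less_divisor)
  then show ?thesis
    unfolding E_def m_def by (rule has_mean_if_bounded_discrepancy)
qed

text \<open>
  Mean values survive approximation in the mean: the means of approximants that are close to the same
function are close to each other, so they form a Cauchy sequence, and its limit is the mean of the
approximated function. In particular the existence of the mean comes for free.
\<close>

lemma has_mean_limit:
  assumes g: "\<And>k. has_mean (g k) (m k)"
    and close: "\<And>e. e > 0 \<Longrightarrow>
      \<forall>\<^sub>F k in sequentially. \<forall>\<^sub>F N in sequentially. (\<Sum>n=1..N. \<bar>f n - g k n\<bar>) \<le> e * real N"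
  obtains l where "m \<longlonglongrightarrow> l" "has_mean f l"
proof -
  define A where "A u N = (\<Sum>n=1..N. u n) / real N" for u :: "nat \<Rightarrow> real" and N
  have gA: "(\<lambda>N. A (g k) N) \<longlonglongrightarrow> m k" for k
    using g by (simp add: A_def has_mean_def)
  have "\<exists>K. \<forall>k\<ge>K. \<forall>\<^sub>F N in sequentially. \<bar>A f N - m k\<bar> \<le> e" if e: "e > 0" for e
  proof -
    obtain K where K: "\<And>k. k \<ge> K \<Longrightarrow>
        \<forall>\<^sub>F N in sequentially. (\<Sum>n=1..N. \<bar>f n - g k n\<bar>) \<le> (e/2) * real N"
      using close[of "e/2"] e by (auto simp: eventually_sequentially)
    have "\<forall>\<^sub>F N in sequentially. \<bar>A f N - m k\<bar> \<le> e" if "k \<ge> K" for k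
    proof -
      have "\<forall>\<^sub>F N in sequentially. dist (A (g k) N) (m k) < e/2"
        using tendstoD[OF gA[of k], of "e/2"] e by simp
      with K[OF that] eventually_gt_at_top[of 0] show ?thesis
      proof eventually_elim
        case (elim N)
        have "\<bar>A f N - A (g k) N\<bar> = \<bar>\<Sum>n=1..N. f n - g k n\<bar> / real N"
          by (simp add: A_def sum_subtractf flip: diff_divide_distrib)
        also have "\<dots> \<le> (\<Sum>n=1..N. \<bar>f n - g k n\<bar>) / real N"
          by (intro divide_right_mono sum_abs) auto
        also have "\<dots> \<le> e/2" using elim by (simp add: field_simps)
        finally show ?case using elim(3) unfolding dist_real_def by linarith
      qed
    qed
    then show ?thesis by blast
  qed note main = this
  have "Cauchy m"
  proof (rule metric_CauchyI)
    fix e :: real assume e: "e > 0"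
    obtain K where K: "\<And>k. k \<ge> K \<Longrightarrow> \<forall>\<^sub>F N in sequentially. \<bar>A f N - m k\<bar> \<le> e/3"
      using main[of "e/3"] e by auto
    have "dist (m j) (m k) < e" if "j \<ge> K" "k \<ge> K" for j k
    proof -
      have "\<forall>\<^sub>F N in sequentially. dist (m j) (m k) < e"
        using K[OF that(1)] K[OF that(2)]
        by eventually_elim (use e in \<open>unfold dist_real_def, linarith\<close>)
      then show ?thesis by simp
    qed
    then show "\<exists>M. \<forall>m'\<ge>M. \<forall>n\<ge>M. dist (m m') (m n) < e" by blast
  qed
  then obtain l where l: "m \<longlonglongrightarrow> l"
    using Cauchy_convergent_iff convergent_def by blast
  have "(\<lambda>N. A f N) \<longlonglongrightarrow> l"
  proof (rule tendstoI)
    fix e :: real assume e: "e > 0"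
    obtain K where K: "\<And>k. k \<ge> K \<Longrightarrow> \<forall>\<^sub>F N in sequentially. \<bar>A f N - m k\<bar> \<le> e/3"
      using main[of "e/3"] e by auto
    have "\<forall>\<^sub>F k in sequentially. k \<ge> K \<and> dist (m k) l < e/3"
      using eventually_ge_at_top[of K] tendstoD[OF l, of "e/3"] e unfolding less_divide_eq_numeral1
      by (simp add: eventually_conj)
    then obtain k where k: "k \<ge> K" "dist (m k) l < e/3"
      using eventually_happens' sequentially_bot by blast
    show "\<forall>\<^sub>F N in sequentially. dist (A f N) l < e"
      using K[OF k(1)] by eventually_elim (use k(2) e in \<open>unfold dist_real_def, linarith\<close>)
  qed
  then have "has_mean f l" by (simp add: has_mean_def A_def)
  with l that show thesis by blast
qed

text \<open>
  The Chinese Remainder Theorem: $n \mapsto (n \bmod A, n \bmod B)$ maps the residues modulo $AB$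
bijectively onto pairs of residues, so that the sum over a period factorises.
\<close>

lemma sum_mult_coprime_periods:
  fixes f g :: "nat \<Rightarrow> real"
  assumes A: "A > 0" and B: "B > 0" and cop: "coprime A B"
    and f: "\<And>n. f (n + A) = f n" and g: "\<And>n. g (n + B) = g n"
  shows "(\<Sum>n<A*B. f n * g n) = (\<Sum>n<A. f n) * (\<Sum>n<B. g n)"
proof -
  have fm: "f (n mod A) = f n" and gm: "g (n mod B) = g n" for n
    using periodic_mod[of f A] periodic_mod[of g B] f g by simp_all
  let ?\<phi> = "\<lambda>n. (n mod A, n mod B)"
  have inj: "inj_on ?\<phi> {..<A*B}"
  proof (rule inj_onI)
    fix x y assume xy: "x \<in> {..<A*B}" "y \<in> {..<A*B}" "?\<phi> x = ?\<phi> y"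
    then have "[x = y] (mod A * B)"
      using cop by (intro coprime_cong_mult_nat) (auto simp: cong_def)
    then show "x = y" using xy by (simp add: cong_less_modulus_unique_nat)
  qed
  have "?\<phi> ` {..<A*B} = {..<A} \<times> {..<B}"
    by (rule card_subset_eq) (use A B in \<open>auto simp: card_image[OF inj]\<close>)
  then have "(\<Sum>z\<in>{..<A} \<times> {..<B}. f (fst z) * g (snd z)) = (\<Sum>n<A*B. f n * g n)"
    using sum.reindex[OF inj, of "\<lambda>z. f (fst z) * g (snd z)"] by (simp add: fm gm)
  then show ?thesis
    by (simp add: sum_product sum.cartesian_product case_prod_beta)
qed

text \<open>
  Independence of periodic functions with pairwise coprime periods. The mean of a periodic function is its average over
one period, which turns the claim into an induction on \<open>sum_mult_coprime_periods\<close>.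
\<close>

lemma has_mean_prod_periodic:
  fixes f :: "'i \<Rightarrow> nat \<Rightarrow> real"
  assumes "finite I" and D: "\<And>i. i \<in> I \<Longrightarrow> D i > 0"
    and cop: "\<And>i j. i \<in> I \<Longrightarrow> j \<in> I \<Longrightarrow> i \<noteq> j \<Longrightarrow> coprime (D i) (D j)"
    and per: "\<And>i n. i \<in> I \<Longrightarrow> f i (n + D i) = f i n"
    and m: "\<And>i. i \<in> I \<Longrightarrow> has_mean (f i) (m i)"
  shows "has_mean (\<lambda>n. \<Prod>i\<in>I. f i n) (\<Prod>i\<in>I. m i)"
proof -
  have m_eq: "m i = (\<Sum>n<D i. f i n) / real (D i)" if "i \<in> I" for i
    by (rule has_mean_unique[OF m[OF that] has_mean_periodic]) (use D per that in auto)
  have main: "(\<forall>n. (\<Prod>i\<in>J. f i (n + prod D J)) = (\<Prod>i\<in>J. f i n)) \<and>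
        (\<Sum>n<prod D J. \<Prod>i\<in>J. f i n) / real (prod D J) = (\<Prod>i\<in>J. m i)"
    if "finite J" "J \<subseteq> I" for J
    using that
  proof (induction J)
    case empty
    show ?case by simp
  next
    case (insert j J)
    let ?F = "\<lambda>n. \<Prod>i\<in>J. f i n"
    from insert have IH: "\<And>n. ?F (n + prod D J) = ?F n"
      "(\<Sum>n<prod D J. ?F n) / real (prod D J) = (\<Prod>i\<in>J. m i)" and j: "j \<in> I" by auto
    have fq: "f j (n + q * D j) = f j n" for n q
      using per[OF j] by (rule periodic_mult)
    have Fq: "?F (n + q * prod D J) = ?F n" for n q
      using IH(1) by (rule periodic_mult)
    have "coprime (D j) (prod D J)"
      using insert j by (intro prod_coprime_right cop) auto
    moreover have "prod D J > 0" using insert D by (intro prod_pos) auto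
    ultimately have "(\<Sum>n<D j * prod D J. f j n * ?F n) = (\<Sum>n<D j. f j n) * (\<Sum>n<prod D J. ?F n)"
      using sum_mult_coprime_periods[of "D j" "prod D J" "f j" ?F] D[OF j] per[OF j] IH(1) by blast
    then have "(\<Sum>n<D j * prod D J. f j n * ?F n) / real (D j * prod D J)
        = m j * (\<Prod>i\<in>J. m i)"
      by (simp add: m_eq[OF j] IH(2)[symmetric])
    moreover have "f j (n + D j * prod D J) * ?F (n + D j * prod D J) = f j n * ?F n" for n
      using fq[of n "prod D J"] Fq[of n "D j"] by (simp add: mult.commute)
    ultimately show ?case using insert by simp
  qed
  from main[OF assms(1) subset_refl] D show ?thesis
    using has_mean_periodic[of "prod D I" "\<lambda>n. \<Prod>i\<in>I. f i n"]
    by (simp add: prod_pos)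
qed

lemma sum_of_bool_dvd_shift:
  "(\<Sum>n=1..N. of_bool (D dvd n + h)) + real (h div D) = real ((N + h) div D)"
proof (induction N)
  case (Suc N)
  then show ?case by (simp add: div_Suc dvd_eq_mod_eq_0)
qed simp

lemma has_mean_dvd:
  assumes D: "D > 0"
  shows "has_mean (\<lambda>n. of_bool (D dvd n + h)) (1 / real D)"
proof (rule has_mean_if_bounded_discrepancy)
  fix N
  have div_bounds: "real a / real D - 1 \<le> real (a div D)" "real (a div D) \<le> real a / real D" for a
  proof -
    have "real a = real D * real (a div D) + real (a mod D)"
      by (metis mult_div_mod_eq of_nat_add of_nat_mult)
    moreover have "real (a mod D) \<le> real D" using D by (simp add: less_imp_le)
    ultimately show "real a / real D - 1 \<le> real (a div D)" "real (a div D) \<le> real a / real D"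
      using D by (simp_all add: field_simps)
  qed
  have "(\<Sum>n=1..N. of_bool (D dvd n + h)) = real ((N + h) div D) - real (h div D)"
    using sum_of_bool_dvd_shift[where D = D and h = h and N = N] by linarith
  then show "\<bar>(\<Sum>n=1..N. of_bool (D dvd n + h)) - 1 / real D * real N\<bar> \<le> 1"
    using div_bounds[of "N + h"] div_bounds[of h] by (simp add: add_divide_distrib)
qed

text \<open>
  A bound without an additive error for each modulus. Counting multiples of $D$ up to $N + h$ by
$(N+h)/D$ makes it possible to sum over arbitrarily many moduli later, where a bound $N/D + 1$
would fail.
\<close>

lemma sum_of_bool_dvd_le:
  assumes "D > 0" "finite H" "\<And>h. h \<in> H \<Longrightarrow> h \<le> N"
  shows "(\<Sum>n=1..N. \<Sum>h\<in>H. of_bool (D dvd n + h)) \<le> 2 * real (card H) * real N / real D"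
proof -
  have "(\<Sum>n=1..N. \<Sum>h\<in>H. of_bool (D dvd n + h)) = (\<Sum>h\<in>H. \<Sum>n=1..N. of_bool (D dvd n + h) :: real)"
    by (rule sum.swap)
  also have "\<dots> \<le> (\<Sum>h\<in>H. 2 * real N / real D)"
  proof (rule sum_mono)
    fix h assume h: "h \<in> H"
    have "(\<Sum>n=1..N. of_bool (D dvd n + h) :: real) \<le> real ((N + h) div D)"
      using sum_of_bool_dvd_shift[where D = D and h = h and N = N] by linarith
    also have "\<dots> \<le> real (N + h) / real D" by (rule of_nat_div_le_of_nat)
    also have "\<dots> \<le> 2 * real N / real D"
      using assms(3)[OF h] by (intro divide_right_mono) auto
    finally show "(\<Sum>n=1..N. of_bool (D dvd n + h)) \<le> 2 * real N / real D" .
  qed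
  finally show ?thesis by (simp add: mult_ac)
qed

section \<open>The correlations and their local factors\<close>

lemma lambda_fun_cases: "lambda_fun P n = 1 \<or> lambda_fun P n = -1"
proof -
  have "(\<Prod>p\<in>#M. if p \<in> P then -1 else 1 :: real) \<in> {1, -1}" for M
    by (induction M) auto
  then show ?thesis by (simp add: lambda_fun_def)
qed

lemma abs_lambda_fun [simp]: "\<bar>lambda_fun P n\<bar> = 1"
  using lambda_fun_cases[of P n] by auto

lemma abs_Lambda_corr [simp]: "\<bar>Lambda_corr H P n\<bar> = 1"
  by (simp add: Lambda_corr_def abs_prod)

lemma Lambda_corr_cases: "Lambda_corr H P n = 1 \<or> Lambda_corr H P n = -1"
  using abs_Lambda_corr[of H P n] by linarith

lemma lambda_fun_Un:
  assumes "P \<inter> Q = {}"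
  shows "lambda_fun (P \<union> Q) n = lambda_fun P n * lambda_fun Q n"
  unfolding lambda_fun_def prod_mset.distrib[symmetric]
  by (intro arg_cong[where f = prod_mset] image_mset_cong) (use assms in auto)

lemma lambda_fun_eq_1:
  assumes "\<And>p. p \<in> P \<Longrightarrow> \<not> p dvd n"
  shows "lambda_fun P n = 1"
  unfolding lambda_fun_def using assms
  by (intro prod_mset.neutral) (auto dest: in_prime_factors_imp_dvd)

lemma Lambda_corr_Un:
  assumes "P \<inter> Q = {}"
  shows "Lambda_corr H (P \<union> Q) n = Lambda_corr H P n * Lambda_corr H Q n"
  by (simp add: Lambda_corr_def lambda_fun_Un[OF assms] prod.distrib)

lemma Lambda_corr_eq_prod:
  assumes "finite P"
  shows "Lambda_corr H P n = (\<Prod>p\<in>P. Lambda_corr H {p} n)"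
  using assms
proof (induction P)
  case empty
  show ?case by (simp add: Lambda_corr_def lambda_fun_def)
next
  case (insert p P)
  then show ?case using Lambda_corr_Un[of "{p}" P H n] by simp
qed

text \<open>
  Replacing $n+h$ by its greatest common divisor with $p^k$ caps the exponent of $p$ at $k$. This makes the
local correlation periodic modulo $p^k$.
\<close>

definition truncated_corr :: "nat set \<Rightarrow> nat \<Rightarrow> nat \<Rightarrow> nat \<Rightarrow> real" where
  "truncated_corr H p k n = (\<Prod>h\<in>H. lambda_fun {p} (gcd (n + h) (p ^ k)))"

lemma abs_truncated_corr [simp]: "\<bar>truncated_corr H p k n\<bar> = 1"
  by (simp add: truncated_corr_def abs_prod)

lemma truncated_corr_periodic: "truncated_corr H p k (n + p ^ k) = truncated_corr H p k n"
proof -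
  have "gcd (n + p ^ k + h) (p ^ k) = gcd (n + h) (p ^ k)" for h
    by (metis add.assoc add.commute gcd_add1)
  then show ?thesis by (simp add: truncated_corr_def)
qed

text \<open>
  Both sides equal $(-1)^v$, where $p^v$ is the exact power of $p$ in $m$; since $v < k$, capping the
exponent has no effect.
\<close>

lemma lambda_fun_gcd_prime_power:
  assumes p: "prime p" and m: "m > 0" and "\<not> p ^ k dvd m"
  shows "lambda_fun {p} (gcd m (p ^ k)) = lambda_fun {p} m"
proof -
  obtain x where x: "m = p ^ multiplicity p m * x" "\<not> p dvd x"
    using multiplicity_decompose'[of m p] p m by (metis not_prime_unit gr_implies_not0)
  let ?j = "multiplicity p m"
  have "?j < k" using assms by (metis multiplicity_dvd' not_le)
  then have "p ^ k = p ^ ?j * p ^ (k - ?j)" by (simp flip: power_add)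
  moreover have "coprime x (p ^ (k - ?j))"
    using x(2) p by (metis coprime_commute coprime_power_right_iff prime_imp_coprime)
  ultimately have "gcd m (p ^ k) = p ^ ?j"
    using x(1) by (metis coprime_imp_gcd_eq_1 gcd_mult_distrib_nat mult.right_neutral)
  moreover have "lambda_fun {p} m = lambda_fun {p} (p ^ ?j) * lambda_fun {p} x"
    using lambda_fun_mult[of "p ^ ?j" x "{p}"] x(1) m p
    by (metis gr0I mult_is_0 not_gr_zero)
  moreover have "lambda_fun {p} x = 1" using x(2) by (intro lambda_fun_eq_1) auto
  ultimately show ?thesis by simp
qed

lemma truncated_corr_error:
  assumes "prime p" "n \<ge> 1"
  shows "\<bar>Lambda_corr H {p} n - truncated_corr H p k n\<bar> \<le> 2 * (\<Sum>h\<in>H. of_bool (p ^ k dvd n + h))"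
proof -
  have "\<bar>Lambda_corr H {p} n - truncated_corr H p k n\<bar>
      \<le> (\<Sum>h\<in>H. \<bar>lambda_fun {p} (n + h) - lambda_fun {p} (gcd (n + h) (p ^ k))\<bar>)"
    unfolding Lambda_corr_def truncated_corr_def real_norm_def[symmetric]
    by (rule norm_prod_diff) auto
  also have "\<dots> \<le> (\<Sum>h\<in>H. 2 * of_bool (p ^ k dvd n + h))"
  proof (rule sum_mono)
    fix h
    show "\<bar>lambda_fun {p} (n + h) - lambda_fun {p} (gcd (n + h) (p ^ k))\<bar> \<le> 2 * of_bool (p ^ k dvd n + h)"
    proof (cases "p ^ k dvd n + h")
      case True
      have "\<bar>lambda_fun {p} (n + h) - lambda_fun {p} (gcd (n + h) (p ^ k))\<bar> \<le> 1 + 1"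
        by (rule order_trans[OF abs_triangle_ineq4]) simp
      then show ?thesis using True by simp
    next
      case False
      then show ?thesis using lambda_fun_gcd_prime_power[of p "n + h" k] assms by simp
    qed
  qed
  finally show ?thesis by (simp add: sum_distrib_left)
qed

text \<open>
  Only the integers $n$ with $p^k$ dividing some $n + h$ contribute, and their upper density decays
geometrically in $k$.
\<close>

lemma truncated_corr_close:
  assumes p: "prime p" and H: "finite H" and e: "e > 0"
  shows "\<forall>\<^sub>F k in sequentially. \<forall>\<^sub>F N in sequentially.
           (\<Sum>n=1..N. \<bar>Lambda_corr H {p} n - truncated_corr H p k n\<bar>) \<le> e * real N"
proof -
  have "p > 1" using p by (rule prime_gt_1_nat)
  then have "(\<lambda>k. 4 * real (card H) * (1 / real p) ^ k) \<longlonglongrightarrow> 4 * real (card H) * 0"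
    by (intro tendsto_mult tendsto_const LIMSEQ_power_zero) simp
  then have "\<forall>\<^sub>F k in sequentially. 4 * real (card H) * (1 / real p) ^ k < e"
    using e by (auto dest: order_tendstoD)
  then show ?thesis
  proof eventually_elim
    case (elim k)
    show ?case using eventually_ge_at_top[of "\<Sum>H"]
    proof eventually_elim
      case (elim N)
      have le: "h \<le> N" if "h \<in> H" for h
        using elim member_le_sum[of h H "\<lambda>x. x"] that H by simp
      have "(\<Sum>n=1..N. \<bar>Lambda_corr H {p} n - truncated_corr H p k n\<bar>)
          \<le> (\<Sum>n=1..N. 2 * (\<Sum>h\<in>H. of_bool (p ^ k dvd n + h)))"
        using p by (intro sum_mono truncated_corr_error) auto
      also have "\<dots> \<le> 2 * (2 * real (card H) * real N / real (p ^ k))"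
        unfolding sum_distrib_left[symmetric]
        using sum_of_bool_dvd_le[of "p ^ k" H N] H le \<open>p > 1\<close> by simp
      also have "\<dots> = 4 * real (card H) * (1 / real p) ^ k * real N"
        by (simp add: power_divide)
      also have "\<dots> \<le> e * real N"
        using \<open>4 * real (card H) * (1 / real p) ^ k < e\<close> by (intro mult_right_mono) auto
      finally show ?case .
    qed
  qed
qed

text \<open>
  For a function with values $\pm 1$ the indicator of the value $-1$ is $(1 - \Lambda)/2$.
\<close>

lemma eta_if_has_mean:
  assumes "has_mean (Lambda_corr H {p}) l"
  shows "eta H p = (1 - l) / 2"
proof -
  have "has_mean (\<lambda>n. (1/2) * (1 - Lambda_corr H {p} n)) ((1/2) * (1 - l))"
    by (intro has_mean_cmult has_mean_diff has_mean_const assms)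
  moreover have "(1/2) * (1 - Lambda_corr H {p} n) = of_bool (Lambda_corr H {p} n = -1)" for n
    using Lambda_corr_cases[of H "{p}" n] by auto
  moreover have "(\<Sum>n=1..N. of_bool (Lambda_corr H {p} n = -1)) =
      real (card ({n. n \<ge> 1 \<and> Lambda_corr H {p} n = -1} \<inter> {1..N}))" for N
  proof -
    have "{n. n \<ge> 1 \<and> Lambda_corr H {p} n = -1} \<inter> {1..N} = {1..N} \<inter> {n. Lambda_corr H {p} n = -1}"
      by auto
    then show ?thesis by (simp add: of_bool_def sum.If_cases)
  qed
  ultimately have "(\<lambda>N. real (card ({n. n \<ge> 1 \<and> Lambda_corr H {p} n = -1} \<inter> {1..N})) / real N)
      \<longlonglongrightarrow> (1/2) * (1 - l)"
    by (simp add: has_mean_def)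
  then show ?thesis by (simp add: eta_def natural_density_def limI)
qed

text \<open>
  The second limit identifies the local mean with the limit of averages over the residues modulo
$p^k$. These averages multiply over different primes, which is how the product formula arises.
\<close>

lemma local_mean:
  assumes p: "prime p" and H: "finite H"
  shows "has_mean (Lambda_corr H {p}) (1 - 2 * eta H p)"
    and "(\<lambda>k. (\<Sum>n<p^k. truncated_corr H p k n) / real (p^k)) \<longlonglongrightarrow> 1 - 2 * eta H p"
proof -
  have "has_mean (truncated_corr H p k) ((\<Sum>n<p^k. truncated_corr H p k n) / real (p^k))" for k
    using p by (intro has_mean_periodic truncated_corr_periodic) (simp add: prime_gt_0_nat)
  from has_mean_limit[OF this truncated_corr_close[OF p H]]
  obtain l where l: "(\<lambda>k. (\<Sum>n<p^k. truncated_corr H p k n) / real (p^k)) \<longlonglongrightarrow> l"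
    "has_mean (Lambda_corr H {p}) l" by blast
  have "1 - 2 * eta H p = l" using eta_if_has_mean[OF l(2)] by simp
  with l show "has_mean (Lambda_corr H {p}) (1 - 2 * eta H p)"
    and "(\<lambda>k. (\<Sum>n<p^k. truncated_corr H p k n) / real (p^k)) \<longlonglongrightarrow> 1 - 2 * eta H p"
    by simp_all
qed

text \<open>
  The product formula for finitely many primes: the truncations at different primes are independent,
and their errors add up since all factors have absolute value at most $1$.
\<close>

lemma has_mean_Lambda_corr_finite:
  assumes P: "finite P" "P \<subseteq> {p. prime p}" and H: "finite H"
  shows "has_mean (Lambda_corr H P) (\<Prod>p\<in>P. 1 - 2 * eta H p)"
proof -
  define m where "m p k = (\<Sum>n<p^k. truncated_corr H p k n) / real (p^k)" for p k
  have pos: "p ^ k > 0" if "p \<in> P" for p k :: nat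
    using P that prime_gt_0_nat by auto
  have mean: "has_mean (\<lambda>n. \<Prod>p\<in>P. truncated_corr H p k n) (\<Prod>p\<in>P. m p k)" for k
  proof (rule has_mean_prod_periodic[where D = "\<lambda>p. p ^ k"])
    show "coprime (p ^ k) (q ^ k)" if "p \<in> P" "q \<in> P" "p \<noteq> q" for p q
      using that P(2) by (simp add: primes_coprime subset_iff)
    show "has_mean (truncated_corr H p k) (m p k)" if "p \<in> P" for p
      unfolding m_def using pos that by (intro has_mean_periodic truncated_corr_periodic) auto
  qed (use P pos truncated_corr_periodic in auto)
  have close: "\<forall>\<^sub>F k in sequentially. \<forall>\<^sub>F N in sequentially.
      (\<Sum>n=1..N. \<bar>Lambda_corr H P n - (\<Prod>p\<in>P. truncated_corr H p k n)\<bar>) \<le> e * real N"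
    if e: "e > 0" for e
  proof -
    define d where "d = e / (real (card P) + 1)"
    have d: "d > 0" "real (card P) * d \<le> e" using e by (auto simp: d_def field_simps)
    have "\<forall>\<^sub>F k in sequentially. \<forall>p\<in>P. \<forall>\<^sub>F N in sequentially.
        (\<Sum>n=1..N. \<bar>Lambda_corr H {p} n - truncated_corr H p k n\<bar>) \<le> d * real N"
      using P H d by (intro eventually_ball_finite ballI truncated_corr_close) auto
    then show ?thesis
    proof eventually_elim
      case (elim k)
      then have "\<forall>\<^sub>F N in sequentially. \<forall>p\<in>P.
          (\<Sum>n=1..N. \<bar>Lambda_corr H {p} n - truncated_corr H p k n\<bar>) \<le> d * real N"
        using P by (intro eventually_ball_finite) auto
      then show ?case
      proof eventually_elim
        case (elim N)
        have "(\<Sum>n=1..N. \<bar>Lambda_corr H P n - (\<Prod>p\<in>P. truncated_corr H p k n)\<bar>)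
            \<le> (\<Sum>n=1..N. \<Sum>p\<in>P. \<bar>Lambda_corr H {p} n - truncated_corr H p k n\<bar>)"
          unfolding Lambda_corr_eq_prod[OF P(1)] real_norm_def[symmetric]
          by (intro sum_mono norm_prod_diff) auto
        also have "\<dots> = (\<Sum>p\<in>P. \<Sum>n=1..N. \<bar>Lambda_corr H {p} n - truncated_corr H p k n\<bar>)"
          by (rule sum.swap)
        also have "\<dots> \<le> (\<Sum>p\<in>P. d * real N)" using elim by (intro sum_mono) auto
        also have "\<dots> = real (card P) * d * real N" by simp
        also have "\<dots> \<le> e * real N" using d by (intro mult_right_mono) auto
        finally show ?case .
      qed
    qed
  qed
  obtain l where l: "(\<lambda>k. \<Prod>p\<in>P. m p k) \<longlonglongrightarrow> l" "has_mean (Lambda_corr H P) l"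
    using has_mean_limit[OF mean close] by blast
  have "(\<lambda>k. \<Prod>p\<in>P. m p k) \<longlonglongrightarrow> (\<Prod>p\<in>P. 1 - 2 * eta H p)"
    using P(2) local_mean(2)[OF _ H] by (intro tendsto_prod) (auto simp: m_def)
  with l show ?thesis using LIMSEQ_unique by metis
qed

lemma small_tail:
  assumes "small P" "e > 0"
  obtains K where "\<And>G. finite G \<Longrightarrow> G \<subseteq> P \<inter> {K..} \<Longrightarrow> (\<Sum>p\<in>G. 1 / real p) < e"
proof -
  have "(\<lambda>p. 1 / real p) summable_on P" using assms by (simp add: small_def)
  then have has: "((\<lambda>p. 1 / real p) has_sum (\<Sum>\<^sub>\<infinity>p\<in>P. 1 / real p)) P" by simp
  let ?S = "\<Sum>\<^sub>\<infinity>p\<in>P. 1 / real p"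
  have "\<forall>\<^sub>F F in finite_subsets_at_top P. (\<Sum>p\<in>F. 1 / real p) > ?S - e"
    using has assms(2) unfolding has_sum_def by (intro order_tendstoD) auto
  then obtain F where F: "finite F" "F \<subseteq> P" "(\<Sum>p\<in>F. 1 / real p) > ?S - e"
    unfolding eventually_finite_subsets_at_top by blast
  show thesis
  proof (rule that)
    fix G assume G: "finite G" "G \<subseteq> P \<inter> {Suc (Max (insert 0 F))..}"
    have disj: "F \<inter> G = {}"
    proof (rule ccontr)
      assume "F \<inter> G \<noteq> {}"
      then obtain x where x: "x \<in> F" "x \<in> G" by blast
      then have "x \<le> Max (insert 0 F)" using F by (intro Max_ge) auto
      then show False using x G by auto
    qed
    have "(\<Sum>p\<in>F \<union> G. 1 / real p) \<le> ?S"
      using F G assms(1) by (intro finite_sum_le_infsum) (auto simp: small_def)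
    then show "(\<Sum>p\<in>G. 1 / real p) < e"
      using F G disj by (simp add: sum.union_disjoint)
  qed
qed

text \<open>
  The two correlations can only differ at $n$ if some prime of $P - Q$ divides some $n + h$. Such a
prime is at most $n + h \le 2N$, so only finitely many primes count for each $N$.
\<close>

lemma Lambda_corr_truncate_error:
  assumes H: "finite H" and "Q \<subseteq> P" and N: "\<And>h. h \<in> H \<Longrightarrow> h \<le> N"
    and P: "P \<subseteq> {p. prime p}"
  shows "(\<Sum>n=1..N. \<bar>Lambda_corr H P n - Lambda_corr H Q n\<bar>)
           \<le> 4 * real (card H) * (\<Sum>p\<in>(P - Q) \<inter> {..2*N}. 1 / real p) * real N"
proof -
  let ?G = "(P - Q) \<inter> {..2*N}"
  have "\<bar>Lambda_corr H P n - Lambda_corr H Q n\<bar> \<le> 2 * (\<Sum>p\<in>?G. \<Sum>h\<in>H. of_bool (p dvd n + h))"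
    if n: "n \<in> {1..N}" for n
  proof (cases "\<exists>p\<in>?G. \<exists>h\<in>H. p dvd n + h")
    case True
    then obtain p h where ph: "p \<in> ?G" "h \<in> H" "p dvd n + h" by blast
    have "1 \<le> (\<Sum>h\<in>H. of_bool (p dvd n + h) :: real)"
      using member_le_sum[of h H "\<lambda>h. of_bool (p dvd n + h) :: real"] ph H by simp
    also have "\<dots> \<le> (\<Sum>p\<in>?G. \<Sum>h\<in>H. of_bool (p dvd n + h))"
      using ph(1) by (intro member_le_sum) (auto intro: sum_nonneg)
    finally have "1 \<le> (\<Sum>p\<in>?G. \<Sum>h\<in>H. of_bool (p dvd n + h) :: real)" .
    moreover have "\<bar>Lambda_corr H P n - Lambda_corr H Q n\<bar> \<le> 1 + 1"
      by (rule order_trans[OF abs_triangle_ineq4]) simp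
    ultimately show ?thesis by linarith
  next
    case False
    have "lambda_fun (P - Q) (n + h) = 1" if h: "h \<in> H" for h
    proof (rule lambda_fun_eq_1)
      fix p assume p: "p \<in> P - Q"
      show "\<not> p dvd n + h"
      proof
        assume dvd: "p dvd n + h"
        then have "p \<le> n + h" using n by (intro dvd_imp_le) auto
        then have "p \<in> ?G" using p n N[OF h] by auto
        then show False using False h dvd by blast
      qed
    qed
    then have "Lambda_corr H (P - Q) n = 1" by (simp add: Lambda_corr_def)
    moreover have "Q \<union> (P - Q) = P" using assms(2) by blast
    ultimately have "Lambda_corr H P n = Lambda_corr H Q n"
      using Lambda_corr_Un[of Q "P - Q" H n] by simp
    then show ?thesis by (simp add: sum_nonneg)
  qed
  then have "(\<Sum>n=1..N. \<bar>Lambda_corr H P n - Lambda_corr H Q n\<bar>)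
      \<le> (\<Sum>n=1..N. 2 * (\<Sum>p\<in>?G. \<Sum>h\<in>H. of_bool (p dvd n + h)))"
    by (intro sum_mono)
  also have "\<dots> = 2 * (\<Sum>p\<in>?G. \<Sum>n=1..N. \<Sum>h\<in>H. of_bool (p dvd n + h))"
    unfolding sum_distrib_left[symmetric] by (subst sum.swap) simp
  also have "\<dots> \<le> 2 * (\<Sum>p\<in>?G. 2 * real (card H) * real N / real p)"
    using P H N prime_gt_0_nat by (intro mult_left_mono sum_mono sum_of_bool_dvd_le) auto
  also have "\<dots> = 4 * real (card H) * (\<Sum>p\<in>?G. 1 / real p) * real N"
    by (simp add: sum_distrib_left sum_distrib_right mult_ac)
  finally show ?thesis .
qed

lemma has_mean_Lambda_corr_small:
  assumes P: "small P" and H: "finite H"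
  obtains l where "(\<lambda>k. \<Prod>p\<in>P \<inter> {..<k}. 1 - 2 * eta H p) \<longlonglongrightarrow> l" "has_mean (Lambda_corr H P) l"
proof -
  have primes: "P \<subseteq> {p. prime p}" using P by (simp add: small_def)
  show thesis
  proof (rule has_mean_limit)
    show "has_mean (Lambda_corr H (P \<inter> {..<k})) (\<Prod>p\<in>P \<inter> {..<k}. 1 - 2 * eta H p)" for k
      using primes H by (intro has_mean_Lambda_corr_finite) auto
    fix e :: real assume e: "e > 0"
    \<comment> \<open>The summand 1 keeps the denominator positive when H is empty.\<close>
    define d where "d = e / (4 * real (card H) + 1)"
    have d: "d > 0" "4 * real (card H) * d \<le> e" using e by (auto simp: d_def field_simps)
    obtain K where K: "\<And>G. finite G \<Longrightarrow> G \<subseteq> P \<inter> {K..} \<Longrightarrow> (\<Sum>p\<in>G. 1 / real p) < d"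
      using small_tail[OF P d(1)] by blast
    show "\<forall>\<^sub>F k in sequentially. \<forall>\<^sub>F N in sequentially.
        (\<Sum>n=1..N. \<bar>Lambda_corr H P n - Lambda_corr H (P \<inter> {..<k}) n\<bar>) \<le> e * real N"
      using eventually_ge_at_top[of K]
    proof eventually_elim
      case (elim k)
      show ?case using eventually_ge_at_top[of "\<Sum>H"]
      proof eventually_elim
        case (elim N)
        have le: "h \<le> N" if "h \<in> H" for h
          using elim member_le_sum[of h H "\<lambda>x. x"] that H by simp
        let ?G = "(P - P \<inter> {..<k}) \<inter> {..2*N}"
        have "(\<Sum>n=1..N. \<bar>Lambda_corr H P n - Lambda_corr H (P \<inter> {..<k}) n\<bar>)
            \<le> 4 * real (card H) * (\<Sum>p\<in>?G. 1 / real p) * real N"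
          using H le primes by (intro Lambda_corr_truncate_error) auto
        also have "\<dots> \<le> 4 * real (card H) * d * real N"
          using K[of ?G] \<open>K \<le> k\<close> by (intro mult_left_mono mult_right_mono) force+
        also have "\<dots> \<le> e * real N" using d by (intro mult_right_mono) auto
        finally show ?case .
      qed
    qed
  qed (rule that)
qed

text \<open>
  The passage from integers to a real variable: $\lfloor x \rfloor / x$ tends to $1$.
\<close>

lemma kappa_if_has_mean:
  assumes "has_mean (Lambda_corr H P) m"
  shows "kappa H P = m"
proof -
  let ?f = "Lambda_corr H P"
  have fl: "filterlim (\<lambda>x::real. nat \<lfloor>x\<rfloor>) sequentially at_top"
    by (intro filterlim_compose[OF filterlim_nat_sequentially] filterlim_floor_sequentially)
  have A: "((\<lambda>x::real. (\<Sum>n=1..nat \<lfloor>x\<rfloor>. ?f n) / real (nat \<lfloor>x\<rfloor>)) \<longlongrightarrow> m) at_top"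
    using filterlim_compose[OF assms[unfolded has_mean_def] fl] .
  have B: "((\<lambda>x::real. real (nat \<lfloor>x\<rfloor>) / x) \<longlongrightarrow> 1) at_top"
  proof (rule tendsto_sandwich)
    show "\<forall>\<^sub>F x::real in at_top. 1 - 1 / x \<le> real (nat \<lfloor>x\<rfloor>) / x"
      using eventually_ge_at_top[of 1]
    proof eventually_elim
      case (elim x)
      have "x - 1 \<le> real (nat \<lfloor>x\<rfloor>)" using elim by linarith
      then have "(x - 1) / x \<le> real (nat \<lfloor>x\<rfloor>) / x" using elim by (intro divide_right_mono) auto
      then show ?case using elim by (simp add: diff_divide_distrib)
    qed
    show "\<forall>\<^sub>F x::real in at_top. real (nat \<lfloor>x\<rfloor>) / x \<le> 1"
      using eventually_ge_at_top[of 1] by eventually_elim (simp add: field_simps)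
    show "((\<lambda>x::real. 1 - 1 / x) \<longlongrightarrow> 1) at_top"
      by (rule tendsto_eq_intros tendsto_divide_0 filterlim_at_top_imp_at_infinity filterlim_ident | simp)+
  qed auto
  have "((\<lambda>x::real. (1 / x) * (\<Sum>n=1..nat \<lfloor>x\<rfloor>. ?f n)) \<longlongrightarrow> m) at_top"
  proof (rule Lim_transform_eventually)
    show "((\<lambda>x::real. (\<Sum>n=1..nat \<lfloor>x\<rfloor>. ?f n) / real (nat \<lfloor>x\<rfloor>) * (real (nat \<lfloor>x\<rfloor>) / x)) \<longlongrightarrow> m) at_top"
      using tendsto_mult[OF A B] by simp
    show "\<forall>\<^sub>F x::real in at_top. (\<Sum>n=1..nat \<lfloor>x\<rfloor>. ?f n) / real (nat \<lfloor>x\<rfloor>) * (real (nat \<lfloor>x\<rfloor>) / x)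
        = (1 / x) * (\<Sum>n=1..nat \<lfloor>x\<rfloor>. ?f n)"
      using eventually_ge_at_top[of 1] by eventually_elim (simp add: field_simps)
  qed
  then show ?thesis unfolding kappa_def by (intro tendsto_Lim) auto
qed

section \<open>Size of the local factors\<close>

lemma local_mean_bounds:
  assumes "prime p" "finite H"
  shows "-1 \<le> 1 - 2 * eta H p" "1 - 2 * eta H p \<le> 1"
proof -
  note m = local_mean(1)[OF assms]
  have L: "- 1 \<le> Lambda_corr H {p} n" "Lambda_corr H {p} n \<le> 1" for n
    using Lambda_corr_cases[of H "{p}" n] by auto
  show "-1 \<le> 1 - 2 * eta H p" using has_mean_mono[OF has_mean_const m] L by blast
  show "1 - 2 * eta H p \<le> 1" using has_mean_mono[OF m has_mean_const] L by blast
qed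

text \<open>
  The value of $\Lambda_{\{p\}}^H(n)$ is $1$ unless $p$ divides one of the numbers $n + h$.
\<close>

lemma local_mean_ge:
  assumes p: "prime p" and H: "finite H"
  shows "1 - 2 * real (card H) / real p \<le> 1 - 2 * eta H p"
proof -
  have "1 - 2 * (\<Sum>h\<in>H. 1 / real p) \<le> 1 - 2 * eta H p"
  proof (rule has_mean_mono)
    show "has_mean (\<lambda>n. 1 - 2 * (\<Sum>h\<in>H. of_bool (p dvd n + h))) (1 - 2 * (\<Sum>h\<in>H. 1 / real p))"
      using H p by (intro has_mean_diff has_mean_const has_mean_cmult has_mean_sum has_mean_dvd)
        (auto simp: prime_gt_0_nat)
    show "has_mean (Lambda_corr H {p}) (1 - 2 * eta H p)" using p H by (rule local_mean)
    fix n :: nat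
    show "1 - 2 * (\<Sum>h\<in>H. of_bool (p dvd n + h)) \<le> Lambda_corr H {p} n"
    proof (cases "\<exists>h\<in>H. p dvd n + h")
      case True
      then obtain h where h: "h \<in> H" "p dvd n + h" by blast
      then have "1 \<le> (\<Sum>h\<in>H. of_bool (p dvd n + h) :: real)"
        using member_le_sum[of h H "\<lambda>h. of_bool (p dvd n + h) :: real"] H by simp
      then show ?thesis using Lambda_corr_cases[of H "{p}" n] by linarith
    next
      case False
      then have "Lambda_corr H {p} n = 1"
        unfolding Lambda_corr_def by (intro prod.neutral ballI lambda_fun_eq_1) auto
      then show ?thesis by (simp add: sum_nonneg)
    qed
  qed
  then show ?thesis by simp
qed

text \<open>
  If $p$ exceeds all elements of $H$, it divides at most one of the numbers $n + h$. Hence every $n$ for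
which $p$ divides $n + h$ exactly once, with $h \<in> H$ fixed, gives the value $-1$, and such $n$ have density
$1/p - 1/p^2 \ge 1/(2p)$.
\<close>

lemma local_mean_le:
  assumes p: "prime p" and H: "finite H" and h: "h \<in> H" and large: "\<And>h. h \<in> H \<Longrightarrow> h < p"
  shows "1 - 2 * eta H p \<le> 1 - 1 / real p"
proof -
  have "1 - 2 * eta H p \<le> 1 - 2 * (1 / real p - 1 / real (p ^ 2))"
  proof (rule has_mean_mono)
    show "has_mean (Lambda_corr H {p}) (1 - 2 * eta H p)" using p H by (rule local_mean)
    show "has_mean (\<lambda>n. 1 - 2 * (of_bool (p dvd n + h) - of_bool (p ^ 2 dvd n + h)))
        (1 - 2 * (1 / real p - 1 / real (p ^ 2)))"
      using p by (intro has_mean_diff has_mean_const has_mean_cmult has_mean_dvd)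
        (auto simp: prime_gt_0_nat)
    fix n :: nat assume n: "n \<ge> 1"
    show "Lambda_corr H {p} n \<le> 1 - 2 * (of_bool (p dvd n + h) - of_bool (p ^ 2 dvd n + h))"
    proof (cases "p dvd n + h \<and> \<not> p ^ 2 dvd n + h")
      case True
      then obtain x where x: "n + h = p * x" by (auto elim: dvdE)
      with True have "\<not> p dvd x" by (auto simp: power2_eq_square)
      then have "lambda_fun {p} x = 1" by (intro lambda_fun_eq_1) auto
      then have h_val: "lambda_fun {p} (n + h) = -1"
        using lambda_fun_mult[of p x "{p}"] lambda_fun_prime[OF p, of "{p}"] x n p
        by (cases "x = 0") (auto simp: prime_gt_0_nat)
      have "lambda_fun {p} (n + h') = 1" if h': "h' \<in> H - {h}" for h'
      proof (rule lambda_fun_eq_1)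
        fix q assume q: "q \<in> {p}"
        show "\<not> q dvd n + h'"
        proof
          assume "q dvd n + h'"
          then have dvd: "p dvd n + h'" "p dvd n + h" using q True by auto
          have "p dvd h' - h" "p dvd h - h'"
            using dvd_diff_nat[OF dvd] dvd_diff_nat[OF dvd(2) dvd(1)] by simp_all
          moreover have "h' - h < p" "h - h' < p"
            using large[OF h] large[of h'] h' by auto
          ultimately have "h' = h" using nat_dvd_not_less by (metis diff_is_0_eq le_antisym not_gr_zero)
          then show False using h' by simp
        qed
      qed
      then have "Lambda_corr H {p} n = -1"
        unfolding Lambda_corr_def using h_val by (subst prod.remove[OF H h]) simp
      then show ?thesis using True by simp
    next
      case False
      then have "(of_bool (p dvd n + h) :: real) \<le> of_bool (p ^ 2 dvd n + h)" by auto
      then have "1 \<le> 1 - 2 * (of_bool (p dvd n + h) - of_bool (p ^ 2 dvd n + h) :: real)"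
        by simp
      then show ?thesis using Lambda_corr_cases[of H "{p}" n] by auto
    qed
  qed
  also have "\<dots> \<le> 1 - 1 / real p"
    using prime_ge_2_nat[OF p] by (simp add: field_simps power2_eq_square)
  finally show ?thesis .
qed

section \<open>Divergence of the sum of the reciprocals of the primes\<close>

lemma squarefree_eq_prod_prime_factors:
  fixes s :: nat
  assumes "squarefree s"
  shows "s = \<Prod>(prime_factors s)"
proof -
  have "s \<noteq> 0" using assms by (metis not_squarefree_0)
  then have "s = (\<Prod>p\<in>prime_factors s. p ^ multiplicity p s)"
    using prod_prime_factors[of s] by simp
  also have "\<dots> = (\<Prod>p\<in>prime_factors s. p)"
    using assms \<open>s \<noteq> 0\<close> squarefree_factorial_semiring'[of s] by (intro prod.cong) auto
  finally show ?thesis .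
qed

text \<open>
  An integer is determined by its squarefree and its square part. Here the former is one of the
products of distinct primes below $K$, and the square root of the latter is at most $M$.
\<close>

lemma card_smooth_le:
  "card {n \<in> {1..M\<^sup>2}. \<forall>p. prime p \<longrightarrow> p dvd n \<longrightarrow> p < K} \<le> 2 ^ K * (M :: nat)"
proof -
  let ?S = "{n \<in> {1..M\<^sup>2}. \<forall>p. prime p \<longrightarrow> p dvd n \<longrightarrow> p < K}"
  let ?\<phi> = "\<lambda>n :: nat. (prime_factors (squarefree_part n), square_part n)"
  have "inj_on ?\<phi> ?S"
  proof (rule inj_onI)
    fix x y assume "?\<phi> x = ?\<phi> y"
    then have "squarefree_part x = squarefree_part y" "square_part x = square_part y"
      using squarefree_eq_prod_prime_factors[OF squarefree_squarefree_part, of x]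
        squarefree_eq_prod_prime_factors[OF squarefree_squarefree_part, of y] by auto
    then show "x = y" using squarefree_decompose[of x] squarefree_decompose[of y] by simp
  qed
  moreover have "?\<phi> ` ?S \<subseteq> Pow {..<K} \<times> {1..M}"
  proof (rule image_subsetI)
    fix n assume n: "n \<in> ?S"
    have "p < K" if "p \<in> prime_factors (squarefree_part n)" for p
    proof -
      have "p dvd squarefree_part n" "prime p" using that by auto
      then have "p dvd n" using squarefree_decompose[of n] by (metis dvd_mult2)
      then show ?thesis using n \<open>prime p\<close> by auto
    qed
    moreover have "square_part n ^ 2 \<le> n"
      using dvd_imp_le[OF square_part_square_dvd[of n]] n by simp
    then have "square_part n ^ 2 \<le> M ^ 2" using n by (elim order_trans) simp
    then have "square_part n \<le> M" by (rule power2_le_imp_le) simp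
    moreover have "square_part n \<ge> 1" using n square_part_0_iff[of n] by (cases "square_part n") auto
    ultimately show "?\<phi> n \<in> Pow {..<K} \<times> {1..M}" by auto
  qed
  ultimately have "card ?S \<le> card (Pow {..<K} \<times> {1..M})"
    by (intro card_inj_on_le) auto
  then show ?thesis by (simp add: card_cartesian_product card_Pow)
qed

text \<open>
  If the primes $p \ge K$ had reciprocal sum below $1/2$, then fewer than half of the integers up to
$N$ would have such a prime factor; but the others number at most $2^K \sqrt N$, which is exactly
$N/2$ for $N = 4^{K+1}$.
\<close>

lemma prime_reciprocals_not_summable: "\<not> summable (\<lambda>n. of_bool (prime n) / real n)"
proof
  let ?f = "\<lambda>n. of_bool (prime n) / real n"
  assume "summable ?f"
  then obtain K where K: "\<And>m n. m \<ge> K \<Longrightarrow> norm (sum ?f {m..<n}) < 1/2"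
    unfolding summable_Cauchy by (metis half_gt_zero_iff zero_less_one)
  \<comment> \<open>This choice balances the count of smooth numbers: twice 2 ^ K * M is M squared.\<close>
  define M :: nat where "M = 2 ^ (K + 1)"
  define N where "N = M\<^sup>2"
  have N: "N > 0" by (simp add: N_def M_def)
  let ?S = "{n \<in> {1..N}. \<forall>p. prime p \<longrightarrow> p dvd n \<longrightarrow> p < K}"
  have "real N - real (card ?S) = (\<Sum>n=1..N. 1 - of_bool (n \<in> ?S))"
  proof -
    have "{1..N} \<inter> {n. n \<in> ?S} = ?S" by auto
    then have "(\<Sum>n=1..N. of_bool (n \<in> ?S)) = real (card ?S)"
      by (simp only: sum_of_bool_eq finite_atLeastAtMost)
    then show ?thesis by (simp only: sum_subtractf) simp
  qed
  also have "\<dots> \<le> (\<Sum>n=1..N. \<Sum>p=K..N. of_bool (prime p) * of_bool (p dvd n))"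
  proof (rule sum_mono)
    fix n assume n: "n \<in> {1..N}"
    show "1 - of_bool (n \<in> ?S) \<le> (\<Sum>p=K..N. of_bool (prime p) * of_bool (p dvd n) :: real)"
    proof (cases "n \<in> ?S")
      case True
      then show ?thesis by (simp add: sum_nonneg)
    next
      case False
      then obtain p where p: "prime p" "p dvd n" "p \<ge> K" using n by auto
      then have "p \<le> N" using n dvd_imp_le[of p n] by auto
      then have "of_bool (prime p) * of_bool (p dvd n)
          \<le> (\<Sum>p=K..N. of_bool (prime p) * of_bool (p dvd n) :: real)"
        using p by (intro member_le_sum) auto
      then show ?thesis using p False by simp
    qed
  qed
  also have "\<dots> = (\<Sum>p=K..N. of_bool (prime p) * (\<Sum>n=1..N. of_bool (p dvd n)))"
    by (subst sum.swap) (simp only: sum_distrib_left)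
  also have "\<dots> \<le> (\<Sum>p=K..N. of_bool (prime p) * (real N / real p))"
  proof (intro sum_mono mult_left_mono)
    fix p :: nat
    have "(\<Sum>n=1..N. of_bool (p dvd n)) = real (N div p)"
      using sum_of_bool_dvd_shift[where D = p and h = 0 and N = N] by simp
    then show "(\<Sum>n=1..N. of_bool (p dvd n)) \<le> real N / real p"
      by (simp only: of_nat_div_le_of_nat)
  qed auto
  also have "\<dots> = real N * (\<Sum>p=K..N. ?f p)"
    by (simp add: sum_distrib_left mult_ac)
  also have "\<dots> < real N * (1/2)"
    using K[of K "Suc N"] N
    by (intro mult_strict_left_mono) (simp_all add: atLeastLessThanSuc_atLeastAtMost abs_less_iff)
  finally have "real N < 2 * real (card ?S)" by simp
  moreover have "card ?S \<le> 2 ^ K * M" unfolding N_def by (rule card_smooth_le)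
  moreover have "2 * (2 ^ K * M) = N" by (simp add: N_def M_def power2_eq_square)
  ultimately show False by linarith
qed

text \<open>
  From $b_p \le 1 - 1/p \le \exp(-1/p)$ and the divergence of $\sum_p 1/p$. The finitely many primes
below $y$ only change the required partial sum by a constant.
\<close>

lemma prefix_products_arbitrarily_small:
  fixes b :: "nat \<Rightarrow> real"
  assumes pos: "\<And>n. b n \<ge> 0" and le1: "\<And>n. b n \<le> 1"
    and le: "\<And>p. prime p \<Longrightarrow> p \<ge> y \<Longrightarrow> b p \<le> 1 - 1 / real p" and e: "e > 0"
  shows "\<exists>N. (\<Prod>n<N. b n) < e"
proof -
  let ?f = "\<lambda>n. of_bool (prime n) / real n"
  have "\<exists>N. (\<Sum>n\<le>N. ?f n) > (\<Sum>n<y. ?f n) - ln (e/2)"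
  proof (rule ccontr)
    assume "\<not> ?thesis"
    then have "(\<Sum>n\<le>N. ?f n) \<le> (\<Sum>n<y. ?f n) - ln (e/2)" for N by (meson not_le)
    then have "summable ?f" by (intro bounded_imp_summable) auto
    then show False using prime_reciprocals_not_summable by blast
  qed
  then obtain N where N: "(\<Sum>n\<le>N. ?f n) > (\<Sum>n<y. ?f n) - ln (e/2)" by blast
  let ?g = "\<lambda>n. if n < y then 0 else ?f n"
  have "(\<Prod>n<Suc N. b n) \<le> (\<Prod>n<Suc N. exp (- ?g n))"
  proof (intro prod_mono conjI pos)
    fix n
    show "b n \<le> exp (- ?g n)"
    proof (cases "prime n \<and> n \<ge> y")
      case True
      then have "b n \<le> 1 + (- (1 / real n))" using le by simp
      also have "\<dots> \<le> exp (- (1 / real n))" by (rule exp_ge_add_one_self)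
      finally show ?thesis using True by simp
    next
      case False
      then show ?thesis using le1[of n] by auto
    qed
  qed
  also have "\<dots> = exp (- (\<Sum>n<Suc N. ?g n))"
    by (simp only: exp_sum[OF finite_lessThan, symmetric] sum_negf)
  also have "\<dots> \<le> exp (ln (e/2))"
  proof -
    have "(\<Sum>n<Suc N. ?f n) \<le> (\<Sum>n<Suc N. ?g n + (if n < y then ?f n else 0))"
      by (intro sum_mono) auto
    also have "\<dots> = (\<Sum>n<Suc N. ?g n) + (\<Sum>n\<in>{..<Suc N} \<inter> {..<y}. ?f n)"
      by (simp add: sum.distrib sum.If_cases lessThan_def del: sum.lessThan_Suc)
    also have "(\<Sum>n\<in>{..<Suc N} \<inter> {..<y}. ?f n) \<le> (\<Sum>n<y. ?f n)"
      by (intro sum_mono2) auto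
    finally show ?thesis using N by (simp add: lessThan_Suc_atMost del: sum.lessThan_Suc)
  qed
  also have "\<dots> < e" using e by simp
  finally show ?thesis by blast
qed

section \<open>The spectrum\<close>

text \<open>
  The prefix products start at $1$ and get arbitrarily small in steps of size at most $e$, so the
first one that is at most $t$ lies within $e$ of $t$.
\<close>

lemma prefix_products_dense:
  fixes b :: "nat \<Rightarrow> real"
  assumes b: "\<And>n. 0 \<le> b n" "\<And>n. b n \<le> 1" "\<And>n. 1 - e \<le> b n"
    and to_0: "\<And>d. d > 0 \<Longrightarrow> \<exists>N. (\<Prod>n<N. b n) < d"
    and t: "0 \<le> t" "t \<le> 1" and e: "e > 0"
  shows "\<exists>N. \<bar>(\<Prod>n<N. b n) - t\<bar> \<le> e"
proof (cases "t = 0")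
  case True
  obtain N where "(\<Prod>n<N. b n) < e" using to_0[OF e] by blast
  moreover have "(\<Prod>n<N. b n) \<ge> 0" using b by (intro prod_nonneg) auto
  ultimately show ?thesis using True by (intro exI[of _ N]) auto
next
  case False
  then obtain N' where "(\<Prod>n<N'. b n) < t" using to_0[of t] t by auto
  then have ex: "\<exists>N. (\<Prod>n<N. b n) \<le> t" using less_imp_le by blast
  define N where "N = (LEAST N. (\<Prod>n<N. b n) \<le> t)"
  have N: "(\<Prod>n<N. b n) \<le> t" unfolding N_def using ex by (rule LeastI_ex)
  show ?thesis
  proof (cases N)
    case 0
    then show ?thesis using N t e by (intro exI[of _ N]) auto
  next
    case (Suc M)
    have M: "(\<Prod>n<M. b n) > t"
      using not_less_Least[of M "\<lambda>N. (\<Prod>n<N. b n) \<le> t"] Suc unfolding N_def by simp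
    have "(\<Prod>n<M. b n) * (1 - b M) \<le> 1 * e"
      using b b(2,3)[of M] by (intro mult_mono prod_le_1) (auto simp: prod_nonneg algebra_simps)
    then have "(\<Prod>n<M. b n) - (\<Prod>n<N. b n) \<le> e" using Suc by (simp add: algebra_simps)
    then show ?thesis using N M by (intro exI[of _ N]) auto
  qed
qed

lemma kappa_finite:
  assumes "finite P" "P \<subseteq> {p. prime p}" "finite H"
  shows "kappa H P = (\<Prod>p\<in>P. 1 - 2 * eta H p)"
  using has_mean_Lambda_corr_finite[OF assms] by (rule kappa_if_has_mean)

lemma small_finite: "finite P \<Longrightarrow> P \<subseteq> {p. prime p} \<Longrightarrow> small P"
  by (simp add: small_def)

lemma abs_prod_local_means_le_1:
  assumes "finite H" "P \<subseteq> {p. prime p}"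
  shows "\<bar>\<Prod>p\<in>P. 1 - 2 * eta H p\<bar> \<le> 1"
  unfolding abs_prod
proof (rule prod_le_1)
  fix p assume "p \<in> P"
  then have "prime p" using assms by blast
  then have "\<bar>1 - 2 * eta H p\<bar> \<le> 1"
    using local_mean_bounds[of p H] assms(1) by linarith
  then show "0 \<le> \<bar>1 - 2 * eta H p\<bar> \<and> \<bar>1 - 2 * eta H p\<bar> \<le> 1" by simp
qed

text \<open>
  A finite set of primes close to realising the value: the primes of $F$ together with the
consecutive primes of a block that starts beyond $F$ and whose product of local means approximates $t$.
Taking $F$ empty yields $[0,1]$, and $F$ a single prime with a negative local mean yields the negative part
of the spectrum.
\<close>

lemma scaled_product_in_spectrum:
  assumes H: "finite H" "H \<noteq> {}" and F: "finite F" "F \<subseteq> {p. prime p}" and t: "0 \<le> t" "t \<le> 1"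
  shows "t * (\<Prod>p\<in>F. 1 - 2 * eta H p) \<in> spectrum H"
  unfolding spectrum_def closure_approachable
proof (intro allI impI)
  fix \<epsilon> :: real assume "\<epsilon> > 0"
  define e where "e = min (\<epsilon>/2) (1/2)"
  have e: "0 < e" "e \<le> 1/2" "e < \<epsilon>" using \<open>\<epsilon> > 0\<close> by (auto simp: e_def)
  obtain h where h: "h \<in> H" using H by blast
  \<comment> \<open>The first summand puts the block beyond F and H; the second makes 2 * card H / p at most e.\<close>
  define y where "y = Suc (Max (F \<union> H)) + nat \<lceil>2 * real (card H) / e\<rceil>"
  have yF: "p < y" if "p \<in> F \<union> H" for p
  proof -
    have "p \<le> Max (F \<union> H)" using that F H by (intro Max_ge) auto
    then show ?thesis by (simp add: y_def)
  qed
  have y_large: "2 * real (card H) / e \<le> real y" unfolding y_def by linarith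
  define Q where "Q N = {p \<in> {..<N}. prime p \<and> y \<le> p}" for N
  define b where "b n = (if prime n \<and> y \<le> n then 1 - 2 * eta H n else 1)" for n
  have prod_b: "(\<Prod>n<N. b n) = (\<Prod>p\<in>Q N. 1 - 2 * eta H p)" for N
    unfolding b_def Q_def by (subst prod.inter_filter) auto
  have b_le: "b n \<le> 1" for n using local_mean_bounds(2)[OF _ H(1)] by (simp add: b_def)
  have b_ge: "1 - e \<le> b n" for n
  proof (cases "prime n \<and> y \<le> n")
    case True
    then have "2 * real (card H) / e \<le> real n" "n > 0" using y_large prime_gt_0_nat by auto
    then have "2 * real (card H) / real n \<le> e" using e by (simp add: field_simps)
    then show ?thesis using local_mean_ge[of n H] True H by (simp add: b_def)
  qed (use e in \<open>auto simp: b_def\<close>)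
  have b_nonneg: "0 \<le> b n" for n using b_ge[of n] e by linarith
  have "\<exists>N. \<bar>(\<Prod>n<N. b n) - t\<bar> \<le> e"
  proof (rule prefix_products_dense[where b = b, OF b_nonneg b_le b_ge _ t e(1)])
    fix d :: real assume "d > 0"
    show "\<exists>N. (\<Prod>n<N. b n) < d"
    proof (rule prefix_products_arbitrarily_small[where b = b, OF b_nonneg b_le _ \<open>d > 0\<close>])
      fix p assume p: "prime p" "y \<le> p"
      have "h' < p" if "h' \<in> H" for h' using yF[of h'] that p(2) by simp
      then show "b p \<le> 1 - 1 / real p"
        using local_mean_le[OF p(1) H(1) h] p by (simp add: b_def)
    qed
  qed
  then obtain N where N: "\<bar>(\<Prod>p\<in>Q N. 1 - 2 * eta H p) - t\<bar> \<le> e" unfolding prod_b by blast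
  have fin: "finite (F \<union> Q N)" and primes: "F \<union> Q N \<subseteq> {p. prime p}"
    using F by (auto simp: Q_def)
  have "F \<inter> Q N = {}"
  proof (rule equals0I)
    fix p assume "p \<in> F \<inter> Q N"
    then show False using yF[of p] by (simp add: Q_def)
  qed
  then have kappa: "kappa H (F \<union> Q N) = (\<Prod>p\<in>F. 1 - 2 * eta H p) * (\<Prod>p\<in>Q N. 1 - 2 * eta H p)"
    using F(1) fin unfolding kappa_finite[OF fin primes H(1)] by (intro prod.union_disjoint) auto
  have F1: "\<bar>\<Prod>p\<in>F. 1 - 2 * eta H p\<bar> \<le> 1"
    using H(1) F(2) by (rule abs_prod_local_means_le_1)
  have "dist (kappa H (F \<union> Q N)) (t * (\<Prod>p\<in>F. 1 - 2 * eta H p))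
      = \<bar>\<Prod>p\<in>F. 1 - 2 * eta H p\<bar> * \<bar>(\<Prod>p\<in>Q N. 1 - 2 * eta H p) - t\<bar>"
    unfolding kappa dist_real_def abs_mult[symmetric] by (simp only: algebra_simps)
  also have "\<dots> \<le> 1 * e" using F1 N by (intro mult_mono) auto
  also have "\<dots> < \<epsilon>" using e by simp
  finally show "\<exists>v\<in>{kappa H P |P. small P}. dist v (t * (\<Prod>p\<in>F. 1 - 2 * eta H p)) < \<epsilon>"
    using small_finite[OF fin primes] by blast
qed

lemma bdd_below_local_means:
  assumes "finite H"
  shows "bdd_below ((\<lambda>p. 1 - 2 * eta H p) ` {p. prime p})"
  using local_mean_bounds(1)[OF _ assms] by (intro bdd_belowI[of _ "-1"]) auto

text \<open>
  All factors have absolute value at most $1$, so a negative product is bounded below by any one of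
its negative factors.
\<close>

lemma prod_local_means_bounds:
  assumes H: "finite H" and P: "finite P" "P \<subseteq> {p. prime p}"
  shows "(\<Prod>p\<in>P. 1 - 2 * eta H p) \<in> {alpha H..1} \<union> {0..1}"
proof -
  let ?\<beta> = "\<lambda>p. 1 - 2 * eta H p"
  have abs1: "\<bar>prod ?\<beta> R\<bar> \<le> 1" if "R \<subseteq> P" for R
    using P that by (intro abs_prod_local_means_le_1[OF H]) blast
  show ?thesis
  proof (cases "prod ?\<beta> P \<ge> 0")
    case True
    then show ?thesis using abs1[of P] by auto
  next
    case False
    then obtain p where p: "p \<in> P" "?\<beta> p < 0" using prod_nonneg[of P ?\<beta>] by (meson not_le)
    have "\<bar>prod ?\<beta> P\<bar> = \<bar>?\<beta> p\<bar> * \<bar>prod ?\<beta> (P - {p})\<bar>"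
      by (simp add: prod.remove[OF P(1) p(1)] abs_mult)
    also have "\<dots> \<le> \<bar>?\<beta> p\<bar> * 1" using abs1[of "P - {p}"] by (intro mult_left_mono) auto
    finally have "?\<beta> p \<le> prod ?\<beta> P" using False p(2) by (simp add: abs_of_neg not_le)
    moreover have "alpha H \<le> ?\<beta> p"
      unfolding alpha_def using bdd_below_local_means[OF H] P p by (intro cINF_lower) auto
    ultimately show ?thesis using False by auto
  qed
qed

lemma kappa_bounds:
  assumes H: "finite H" and P: "small P"
  shows "kappa H P \<in> {alpha H..1} \<union> {0..1}"
proof -
  obtain l where l: "(\<lambda>k. \<Prod>p\<in>P \<inter> {..<k}. 1 - 2 * eta H p) \<longlonglongrightarrow> l" "has_mean (Lambda_corr H P) l"
    using has_mean_Lambda_corr_small[OF P H] by blast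
  have "closed ({alpha H..1} \<union> {0..1})" by (intro closed_Un closed_atLeastAtMost)
  moreover have "(\<Prod>p\<in>P \<inter> {..<k}. 1 - 2 * eta H p) \<in> {alpha H..1} \<union> {0..1}" for k
    using P by (intro prod_local_means_bounds[OF H]) (auto simp: small_def)
  ultimately have "l \<in> {alpha H..1} \<union> {0..1}"
    using l(1) by (rule closed_sequentially)
  then show ?thesis using kappa_if_has_mean[OF l(2)] by simp
qed

theorem proposition3:
  fixes H :: "nat set"
  assumes "finite H" and "H \<noteq> {}"
  shows "spectrum H = {alpha H..1} \<union> {0..1}"
proof
  show "spectrum H \<subseteq> {alpha H..1} \<union> {0..1}"
    unfolding spectrum_def using kappa_bounds[OF assms(1)]
    by (intro closure_minimal closed_Un closed_atLeastAtMost) blast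
  have nonneg: "{0..1} \<subseteq> spectrum H"
    using scaled_product_in_spectrum[OF assms, of "{}"] by auto
  have neg: "{alpha H<..<0} \<subseteq> spectrum H"
  proof
    fix x assume x: "x \<in> {alpha H<..<0}"
    obtain q :: nat where "prime q" using two_is_prime_nat by blast
    then obtain p where p: "prime p" "1 - 2 * eta H p < x"
      using x cINF_less_iff[OF _ bdd_below_local_means[OF assms(1)], of x]
      unfolding alpha_def by auto
    define s where "s = x / (1 - 2 * eta H p)"
    have "0 \<le> s" "s \<le> 1" "x = s * (1 - 2 * eta H p)"
      using x p by (auto simp: s_def field_simps)
    then show "x \<in> spectrum H"
      using scaled_product_in_spectrum[OF assms, of "{p}" s] p by simp
  qed
  have "closure {alpha H<..<0} \<subseteq> spectrum H"
    using neg by (rule closure_minimal) (simp add: spectrum_def)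
  then have *: "{alpha H..0} \<subseteq> spectrum H" if "alpha H < 0"
    using that by simp
  show "{alpha H..1} \<union> {0..1} \<subseteq> spectrum H"
  proof
    fix x assume x: "x \<in> {alpha H..1} \<union> {0..1}"
    show "x \<in> spectrum H"
    proof (cases "0 \<le> x")
      case True
      then show ?thesis using x by (intro subsetD[OF nonneg]) auto
    next
      case False
      then show ?thesis using x by (intro subsetD[OF *]) auto
    qed
  qed
qed

end
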